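(* Let $E$ and $F$ be real inner product spaces, let $n\in\mathbb{N}$ with $3\leq n\leq\dim E$, and let $\phi\colon E\to F$ be a map such that \[ \mathrm{Vol}_n(x_1,\dots,x_n)=\mathrm{Vol}_n(\phi(x_1),\dots,\phi(x_n)) \qquad \text{for all } x_1,\dots,x_n\in E . \] Then the following hold. (i) If $\dim E=n$, then there exist a function $\epsilon\colon E\to\{-1,1\}$ and an equiaffine linear transformation $A\colon E\to F$ such that $\phi(x)=\epsilon(x)Ax$ for all $x\in E$. (ii) If $n<\dim E$, then there exist a function $\epsilon\colon E\to\{-1,1\}$ and a linear (not necessarily surjective) isometry $R\colon E\to F$ such that $\phi(x)=\epsilon(x)Rx$ for all $x\in E$.
   Context: The inner product spaces are not assumed to be complete or finite-dimensional. For vectors $v_1,\dots,v_n$ in a real inner product space, $\mathrm{Vol}_n(v_1,\dots,v_n)$ denotes the usual $n$-dimensional volume of the parallelepiped $\{\sum_{j=1}^n t_jv_j : t_j\in[0,1]\}$, i.e. $\mathrm{Vol}_n(v_1,\dots,v_n)=\sqrt{\det(\langle v_i,v_j\rangle)_{i,j=1}^n}$. For $\dim E=n$, a linear map $A\colon E\to F$ is called equiaffine if the matrix of $A$, represented in some orthonormal bases of $E$ and of the range of $A$, has determinant $\pm1$ (in particular the range of $A$ is $n$-dimensional). *)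

theory Defs
  imports "HOL-Analysis.Inner_Product" "HOL-Library.Extended_Nat" "Jordan_Normal_Form.Determinant"
begin

(* The library's dim is 0 on infinite-dimensional spaces, hence this enat-valued version. *)
definition edim :: "'a::real_vector set \<Rightarrow> enat" where
  "edim S = (if \<exists>B. finite B \<and> span B = span S then enat (dim S) else \<infinity>)"

(* Families of n vectors are functions on nat of which only the values at i < n matter.
   The infix notation for inner is avoided: it clashes with scalar_prod. *)
definition Vol :: "nat \<Rightarrow> (nat \<Rightarrow> 'a::real_inner) \<Rightarrow> real" where
  "Vol n v = sqrt (det (mat n n (\<lambda>(i, j). inner (v i) (v j))))"

definition orthonormal_basis :: "nat \<Rightarrow> (nat \<Rightarrow> 'a::real_inner) \<Rightarrow> 'a set \<Rightarrow> bool" where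
  "orthonormal_basis n e S \<longleftrightarrow>
     (\<forall>i<n. \<forall>j<n. inner (e i) (e j) = (if i = j then 1 else 0)) \<and> span (e ` {..<n}) = S"

definition represents ::
  "nat \<Rightarrow> real mat \<Rightarrow> (nat \<Rightarrow> 'a) \<Rightarrow> (nat \<Rightarrow> 'b) \<Rightarrow> ('a::real_vector \<Rightarrow> 'b::real_vector) \<Rightarrow> bool" where
  "represents n M e f A \<longleftrightarrow>
     M \<in> carrier_mat n n \<and> (\<forall>j<n. A (e j) = (\<Sum>i<n. (M $$ (i, j)) *\<^sub>R f i))"

(* Meant for a finite-dimensional domain; on an infinite-dimensional one no A qualifies. *)
definition equiaffine :: "('a::real_inner \<Rightarrow> 'b::real_inner) \<Rightarrow> bool" where
  "equiaffine A \<longleftrightarrow> linear A \<and>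
     (\<exists>e f M. orthonormal_basis (dim (UNIV :: 'a set)) e UNIV \<and>
        orthonormal_basis (dim (UNIV :: 'a set)) f (range A) \<and>
        represents (dim (UNIV :: 'a set)) M e f A \<and> (det M = 1 \<or> det M = -1))"

definition linear_isometry :: "('a::real_inner \<Rightarrow> 'b::real_inner) \<Rightarrow> bool" where
  "linear_isometry R \<longleftrightarrow> linear R \<and> (\<forall>x y. dist (R x) (R y) = dist x y)"

end

theory Submission imports Defs begin

text \<open>
  Write gram for the Gram determinant, the square of the volume; preserving one is the same as
  preserving the other. The map \<open>\<phi>\<close> is shown to agree up to sign with a linear map, and then the
  linear maps that preserve n-volumes are determined.

  \<^emph>\<open>On an n-dimensional subspace.\<close> Let \<open>e\<close> be a basis of it. Families with nonzero gram determinant are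
  the independent ones, so \<open>\<phi>\<close> preserves independence and dependence. If \<open>z\<close> has a vanishing
  coordinate, replacing the corresponding basis vector by \<open>z\<close> gives a dependent family, whence
  \<open>\<phi> z\<close> lies in the span of the \<open>\<phi> (e i)\<close>. A general \<open>z\<close> has a vanishing coordinate with respect to
  another basis, and here \<open>3 \<le> n\<close> enters (\<open>image_in_span\<close>). Replacing one basis vector
  by \<open>z\<close> multiplies the Gram determinant by the square of a coordinate, so coordinates are preserved up
  to individual signs (\<open>coordinate_square\<close>). Changing signs in the image basis, assume that the sum \<open>w\<close> of
  the \<open>e i\<close> is mapped to the sum of the images. In the basis with \<open>w\<close> in place of \<open>e j\<close>, the
  coordinates of \<open>z\<close> are differences \<open>c i - c j\<close>; preserving their squares too forces a common
  sign (\<open>sign_linear_on_frame\<close>).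

  \<^emph>\<open>Gluing.\<close> Any three vectors lie in an n-dimensional subspace. The local linear maps, normalised to agree
  with \<open>\<phi>\<close> at one fixed vector, coincide wherever they overlap (\<open>sign_linear_glue\<close>), which
  gives a linear \<open>R\<close> on the whole space, of any dimension.

  \<^emph>\<open>The linear case.\<close> In dimension \<open>n\<close>, the square of the determinant of \<open>R\<close> is the Gram determinant of the
  image of an orthonormal basis, which is 1. In larger dimension, let \<open>y 0, ..., y n\<close> be orthonormal and let
  \<open>p\<close> be the orthogonal projection of \<open>R (y n)\<close> onto the span of the other images. For \<open>i < n\<close>, the volume of the
  family \<open>y 0, ..., y (n - 1)\<close> with \<open>y i + b y n\<close> in place of \<open>y i\<close> has square \<open>1 + b\<^sup>2\<close>, without a linear term in \<open>b\<close>;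
  for the images the linear term is twice the i-th coordinate of \<open>p\<close>. So \<open>p = 0\<close>
  (\<open>linear_preserves_orthogonality\<close>), and a linear map preserving orthogonality and volume is an
  isometry.
\<close>

section \<open>Gram determinants\<close>

definition gram :: "nat \<Rightarrow> (nat \<Rightarrow> 'a::real_inner) \<Rightarrow> real" where
  "gram n v = det (mat n n (\<lambda>(i, j). inner (v i) (v j)))"

lemma gram_cong: "(\<And>i. i < n \<Longrightarrow> v i = w i) \<Longrightarrow> gram n v = gram n w"
  unfolding gram_def by (intro arg_cong[where f = det] eq_matI) auto

text \<open>The Gram matrix of the new family is \<open>M G M\<^sup>T\<close>.\<close>

lemma gram_change_of_basis:
  assumes M: "M \<in> carrier_mat n n"
  shows "gram n (\<lambda>i. \<Sum>j<n. M $$ (i, j) *\<^sub>R v j) = (det M)\<^sup>2 * gram n v"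
proof -
  let ?G = "mat n n (\<lambda>(i, j). inner (v i) (v j))"
  have "mat n n (\<lambda>(i, j). inner (\<Sum>k<n. M $$ (i, k) *\<^sub>R v k) (\<Sum>l<n. M $$ (j, l) *\<^sub>R v l))
      = M * ?G * M\<^sup>T"
  proof (rule eq_matI)
    fix i j assume "i < dim_row (M * ?G * M\<^sup>T)" "j < dim_col (M * ?G * M\<^sup>T)"
    then have ij: "i < n" "j < n" using M by auto
    have "(M * ?G * M\<^sup>T) $$ (i, j)
        = (\<Sum>l<n. (\<Sum>k<n. M $$ (i, k) * inner (v k) (v l)) * M $$ (j, l))"
      using M ij by (auto simp: scalar_prod_def atLeast0LessThan intro!: sum.cong)
    also have "\<dots> = inner (\<Sum>k<n. M $$ (i, k) *\<^sub>R v k) (\<Sum>l<n. M $$ (j, l) *\<^sub>R v l)"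
      by (simp add: inner_sum_left inner_sum_right sum_distrib_right sum_distrib_left mult_ac)
    finally show "mat n n (\<lambda>(i, j). inner (\<Sum>k<n. M $$ (i, k) *\<^sub>R v k)
        (\<Sum>l<n. M $$ (j, l) *\<^sub>R v l)) $$ (i, j) = (M * ?G * M\<^sup>T) $$ (i, j)"
      using ij by simp
  qed (use M in auto)
  moreover have "det (M * ?G * M\<^sup>T) = det M * det ?G * det M"
    using M by (subst det_mult[where n = n], simp, simp, subst det_mult[where n = n], simp, simp)
       (simp add: det_transpose)
  ultimately show ?thesis
    unfolding gram_def by (simp add: power2_eq_square)
qed

text \<open>The transition matrix is the identity with row \<open>k\<close> replaced by \<open>a\<close>; Cramer's rule for the
  identity matrix gives its determinant, up to transposition.\<close>

lemma gram_replace: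
  assumes "k < n"
  shows "gram n (v(k := \<Sum>i<n. a i *\<^sub>R v i)) = (a k)\<^sup>2 * gram n v"
proof -
  define M where "M = (replace_col (1\<^sub>m n) (1\<^sub>m n *\<^sub>v vec n a) k)\<^sup>T"
  have M: "M \<in> carrier_mat n n"
    by (simp add: M_def replace_col_def)
  have det: "det M = a k"
    using cramer_lemma_mat[of "1\<^sub>m n" n "vec n a" k] assms
    unfolding M_def by (subst det_transpose[of _ n]) (auto simp: replace_col_def)
  have M_index: "M $$ (i, j) = (if i = k then a j else if i = j then 1 else 0)" if "i < n" "j < n" for i j
    using that assms by (auto simp: M_def replace_col_def)
  have "gram n (v(k := \<Sum>i<n. a i *\<^sub>R v i)) = gram n (\<lambda>i. \<Sum>j<n. M $$ (i, j) *\<^sub>R v j)"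
  proof (rule gram_cong)
    fix i assume i: "i < n"
    have "(\<Sum>j<n. M $$ (i, j) *\<^sub>R v j)
        = (\<Sum>j<n. (if i = k then a j else if i = j then 1 else 0) *\<^sub>R v j)"
      using i by (intro sum.cong) (auto simp: M_index)
    also have "\<dots> = (v(k := \<Sum>i<n. a i *\<^sub>R v i)) i"
      using i by (simp add: if_distrib[of "\<lambda>c. c *\<^sub>R _"] cong: if_cong)
    finally show "(v(k := \<Sum>i<n. a i *\<^sub>R v i)) i = (\<Sum>j<n. M $$ (i, j) *\<^sub>R v j)" ..
  qed
  then show ?thesis
    using gram_change_of_basis[OF M] det by simp
qed

text \<open>A vector \<open>c\<close> in the kernel of the Gram matrix makes the combination of the \<open>v i\<close> orthogonal to each
  \<open>v i\<close>, hence to itself.\<close>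

lemma gram_eq_0_iff:
  "gram n v = 0 \<longleftrightarrow> (\<exists>c. (\<exists>i<n. c i \<noteq> 0) \<and> (\<Sum>i<n. c i *\<^sub>R v i) = 0)"
proof
  let ?G = "mat n n (\<lambda>(i, j). inner (v i) (v j))"
  have G: "?G \<in> carrier_mat n n" by simp
  assume "gram n v = 0"
  then obtain x where x: "x \<in> carrier_vec n" "x \<noteq> 0\<^sub>v n" "?G *\<^sub>v x = 0\<^sub>v n"
    unfolding gram_def using det_0_iff_vec_prod_zero[OF G] by blast
  let ?s = "\<Sum>j<n. (x $ j) *\<^sub>R v j"
  have "inner (v i) ?s = 0" if "i < n" for i
  proof -
    have "inner (v i) ?s = (?G *\<^sub>v x) $ i"
      using x(1) that
      by (auto simp: scalar_prod_def atLeast0LessThan inner_sum_right mult_ac intro!: sum.cong)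
    then show ?thesis using x(3) that by simp
  qed
  then have "inner ?s ?s = 0"
    by (subst inner_sum_left) simp
  moreover have "\<exists>i<n. x $ i \<noteq> 0"
    using x(1,2) by (metis carrier_vecD eq_vecI index_zero_vec)
  ultimately show "\<exists>c. (\<exists>i<n. c i \<noteq> 0) \<and> (\<Sum>i<n. c i *\<^sub>R v i) = 0"
    by (intro exI[of _ "\<lambda>i. x $ i"]) simp
next
  assume "\<exists>c. (\<exists>i<n. c i \<noteq> 0) \<and> (\<Sum>i<n. c i *\<^sub>R v i) = 0"
  then obtain c k where c: "k < n" "c k \<noteq> 0" "(\<Sum>i<n. c i *\<^sub>R v i) = 0" by blast
  have "gram n (v(k := 0)) = 0 * gram n v"
    using gram_replace[OF c(1), of v "\<lambda>_. 0"] by simp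
  then show "gram n v = 0"
    using gram_replace[OF c(1), of v c] c by simp
qed

text \<open>The two Gram matrices differ only in the entry at \<open>(k, k)\<close>, and the determinant is affine in that
  entry. The slope \<open>C\<close>, its cofactor, is the Gram determinant of the remaining vectors; all that
  matters below is that it depends on neither \<open>x\<close> nor \<open>w\<close>.\<close>

lemma gram_replace_add_orthogonal:
  assumes "k < n"
  obtains C where "\<And>x w. (\<And>j. j < n \<Longrightarrow> j \<noteq> k \<Longrightarrow> inner w (v j) = 0) \<Longrightarrow> inner x w = 0 \<Longrightarrow>
    gram n (v(k := x + w)) = gram n (v(k := x)) + C * inner w w"
proof -
  define G where "G x = mat n n (\<lambda>(i, j). inner ((v(k := x)) i) ((v(k := x)) j))" for x
  have G: "G x \<in> carrier_mat n n" for x by (simp add: G_def)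
  have cof0: "cofactor (G x) k k = cofactor (G 0) k k" for x
    unfolding cofactor_def mat_delete_def G_def
    by (intro arg_cong2[where f = "(*)"] arg_cong[where f = det] refl eq_matI) auto
  show thesis
  proof (rule that)
    fix x w
    assume w: "\<And>j. j < n \<Longrightarrow> j \<noteq> k \<Longrightarrow> inner w (v j) = 0" and xw: "inner x w = 0"
    have cof: "cofactor (G (x + w)) k j = cofactor (G x) k j" for j
      unfolding cofactor_def mat_delete_def G_def
      by (intro arg_cong2[where f = "(*)"] arg_cong[where f = det] refl eq_matI)
         (auto simp: inner_add_right inner_add_left inner_commute w)
    have row: "G (x + w) $$ (k, j) = G x $$ (k, j) + (if j = k then inner w w else 0)" if "j < n" for j
      using that assms w[of j] xw
      by (auto simp: G_def inner_add_left inner_add_right inner_commute)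
    have "gram n (v(k := x + w)) = (\<Sum>j<n. G (x + w) $$ (k, j) * cofactor (G (x + w)) k j)"
      unfolding gram_def G_def[symmetric] by (rule laplace_expansion_row[OF G assms])
    also have "\<dots> = (\<Sum>j<n. G x $$ (k, j) * cofactor (G x) k j
        + (if j = k then inner w w * cofactor (G x) k k else 0))"
    proof (intro sum.cong refl)
      fix j assume "j \<in> {..<n}"
      then show "G (x + w) $$ (k, j) * cofactor (G (x + w)) k j
          = G x $$ (k, j) * cofactor (G x) k j + (if j = k then inner w w * cofactor (G x) k k else 0)"
        unfolding cof using row[of j] by (simp add: distrib_right)
    qed
    also have "\<dots> = (\<Sum>j<n. G x $$ (k, j) * cofactor (G x) k j) + inner w w * cofactor (G x) k k"
      using assms by (simp add: sum.distrib)
    also have "(\<Sum>j<n. G x $$ (k, j) * cofactor (G x) k j) = gram n (v(k := x))"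
      unfolding gram_def G_def[symmetric] by (rule laplace_expansion_row[OF G assms, symmetric])
    finally show "gram n (v(k := x + w)) = gram n (v(k := x)) + cofactor (G 0) k k * inner w w"
      unfolding cof0[of x] by (simp only: mult.commute)
  qed
qed

lemma gram_sign_cong:
  assumes "\<And>i. i < n \<Longrightarrow> v i = w i \<or> v i = - w i"
  shows "gram n v = gram n w"
proof -
  define s where "s i = (if v i = w i then 1 else -1 :: real)" for i
  define M where "M = mat n n (\<lambda>(i, j). if i = j then s i else 0)"
  have "det M = (\<Prod>i<n. s i)"
    by (subst det_upper_triangular[of _ n])
       (auto simp: M_def prod_list_diag_prod atLeast0LessThan)
  moreover have "(s i)\<^sup>2 = 1" for i by (simp add: s_def)
  ultimately have "(det M)\<^sup>2 = 1"
    by (simp add: prod_power_distrib)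
  moreover have "gram n v = gram n (\<lambda>i. \<Sum>j<n. M $$ (i, j) *\<^sub>R w j)"
  proof (rule gram_cong)
    fix i assume i: "i < n"
    then have "(\<Sum>j<n. M $$ (i, j) *\<^sub>R w j) = (\<Sum>j<n. if i = j then s i *\<^sub>R w j else 0)"
      by (intro sum.cong) (auto simp: M_def)
    also have "\<dots> = v i" using i assms[OF i] by (auto simp: s_def)
    finally show "v i = (\<Sum>j<n. M $$ (i, j) *\<^sub>R w j)" ..
  qed
  ultimately show ?thesis
    using gram_change_of_basis[of M n w] by (simp add: M_def)
qed

lemma replace_by_combination:
  assumes "gram n v \<noteq> 0" "k < n" "gram n (v(k := z)) = 0"
  obtains a where "a k = 0" "z = (\<Sum>i<n. a i *\<^sub>R v i)"
proof -
  obtain d where d: "\<exists>i<n. d i \<noteq> 0" "(\<Sum>i<n. d i *\<^sub>R (v(k := z)) i) = 0"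
    using assms(3) unfolding gram_eq_0_iff by blast
  have split: "(\<Sum>i<n. d i *\<^sub>R (v(k := z)) i) = d k *\<^sub>R z + (\<Sum>i\<in>{..<n} - {k}. d i *\<^sub>R v i)"
    using assms(2) by (subst sum.remove[of _ k]) (auto intro!: sum.cong)
  have eq: "d k *\<^sub>R z = - (\<Sum>i\<in>{..<n} - {k}. d i *\<^sub>R v i)"
    using d(2) unfolding split add_eq_0_iff2 .
  have dk: "d k \<noteq> 0"
  proof
    assume "d k = 0"
    then have "(\<Sum>i<n. d i *\<^sub>R v i) = 0"
      using eq assms(2) by (subst sum.remove[of _ k]) auto
    then show False using d(1) assms(1) gram_eq_0_iff by blast
  qed
  let ?a = "\<lambda>i. if i = k then 0 else - d i / d k"
  have "z = (1 / d k) *\<^sub>R (d k *\<^sub>R z)" using dk by simp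
  also have "\<dots> = (\<Sum>i\<in>{..<n} - {k}. ?a i *\<^sub>R v i)"
    unfolding eq by (simp add: scaleR_sum_right sum_negf[symmetric])
  also have "\<dots> = (\<Sum>i<n. ?a i *\<^sub>R v i)"
    by (intro sum.mono_neutral_left) auto
  finally show thesis by (intro that[of ?a]) auto
qed

section \<open>Orthonormal families\<close>

lemma span_image_lessThan:
  fixes v :: "nat \<Rightarrow> 'a::real_vector"
  assumes "z \<in> span (v ` {..<n})"
  obtains c where "z = (\<Sum>i<n. c i *\<^sub>R v i)"
proof -
  have "\<exists>c. z = (\<Sum>i<n. c i *\<^sub>R v i)"
    using assms
  proof (induction rule: span_induct_alt)
    case base
    show ?case by (intro exI[of _ "\<lambda>_. 0"]) simp
  next
    case (step a x y)
    then obtain k c where kc: "k < n" "x = v k" "y = (\<Sum>i<n. c i *\<^sub>R v i)" by auto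
    have "a *\<^sub>R x + y = (\<Sum>i<n. ((if i = k then a else 0) + c i) *\<^sub>R v i)"
      using kc by (simp add: scaleR_add_left sum.distrib if_distrib[of "\<lambda>c. c *\<^sub>R _"] cong: if_cong)
    then show ?case by (rule exI[of _ "\<lambda>i. (if i = k then a else 0) + c i"])
  qed
  then show thesis using that by blast
qed

lemma sum_scaleR_in_span: "(\<Sum>i<n. c i *\<^sub>R v i) \<in> span (v ` {..<n})"
  by (intro span_sum span_scale span_base) auto

definition orthonormal :: "nat \<Rightarrow> (nat \<Rightarrow> 'a::real_inner) \<Rightarrow> bool" where
  "orthonormal n e \<longleftrightarrow> (\<forall>i<n. \<forall>j<n. inner (e i) (e j) = (if i = j then 1 else 0))"

lemma orthonormal_inner:
  "orthonormal n e \<Longrightarrow> i < n \<Longrightarrow> j < n \<Longrightarrow> inner (e i) (e j) = (if i = j then 1 else 0)"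
  by (simp add: orthonormal_def)

lemma orthonormal_inner_sum:
  assumes "orthonormal n e" "j < n"
  shows "inner (\<Sum>i<n. c i *\<^sub>R e i) (e j) = c j"
  using assms by (simp add: inner_sum_left orthonormal_inner if_distrib[of "\<lambda>x. _ * x"] cong: if_cong)

lemma orthonormal_expansion:
  assumes "orthonormal n e" "z \<in> span (e ` {..<n})"
  shows "(\<Sum>i<n. inner z (e i) *\<^sub>R e i) = z"
proof -
  obtain c where "z = (\<Sum>i<n. c i *\<^sub>R e i)"
    using assms(2) by (rule span_image_lessThan)
  then show ?thesis
    using orthonormal_inner_sum[OF assms(1), of _ c] by simp
qed

lemma gram_orthonormal: "orthonormal n e \<Longrightarrow> gram n e = 1"
proof -
  assume "orthonormal n e"
  then have "mat n n (\<lambda>(i, j). inner (e i) (e j)) = 1\<^sub>m n"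
    by (intro eq_matI) (auto simp: orthonormal_inner)
  then show ?thesis by (simp add: gram_def)
qed

text \<open>The vector in slot \<open>i\<close> stays orthogonal to the others and has squared length \<open>1 + b\<^sup>2\<close>.\<close>

lemma gram_orthonormal_shear:
  assumes y: "orthonormal (Suc n) y" and i: "i < n"
  shows "gram n (y(i := y i + b *\<^sub>R y n)) = 1 + b\<^sup>2"
proof -
  have yn: "orthonormal n y" using y by (simp add: orthonormal_def)
  obtain D where D: "\<And>x w. (\<And>j. j < n \<Longrightarrow> j \<noteq> i \<Longrightarrow> inner w (y j) = 0) \<Longrightarrow> inner x w = 0 \<Longrightarrow>
      gram n (y(i := x + w)) = gram n (y(i := x)) + D * inner w w"
    using gram_replace_add_orthogonal[OF i, of y] by blast
  have "gram n (y(i := 0 + y i)) = gram n (y(i := 0)) + D * inner (y i) (y i)"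
    using i by (intro D) (auto simp: orthonormal_inner[OF yn])
  moreover have "gram n (y(i := 0)) = 0"
    using gram_replace[OF i, of y "\<lambda>_. 0"] by simp
  ultimately have "D = 1"
    using i gram_orthonormal[OF yn] by (simp add: orthonormal_inner[OF yn])
  moreover have "gram n (y(i := y i + b *\<^sub>R y n)) = gram n (y(i := y i)) + D * inner (b *\<^sub>R y n) (b *\<^sub>R y n)"
    using i by (intro D) (auto simp: orthonormal_inner[OF y])
  ultimately show ?thesis
    using gram_orthonormal[OF yn] by (simp add: orthonormal_inner[OF y] power2_eq_square)
qed

lemma orthonormal_residual:
  assumes "orthonormal n e" "j < n"
  shows "inner (z - (\<Sum>i<n. inner z (e i) *\<^sub>R e i)) (e j) = 0"
  using orthonormal_inner_sum[OF assms, of "\<lambda>i. inner z (e i)"] by (simp add: inner_diff_left)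

text \<open>The residual of \<open>x\<close> is normalised and appended, unless \<open>x\<close> adds nothing to the span. Keeping the earlier
  vectors allows a given orthonormal family to be extended.\<close>

lemma Gram_Schmidt_step:
  assumes e: "orthonormal k e"
  obtains k' e' where "k' \<le> Suc k" "x \<notin> span (e ` {..<k}) \<Longrightarrow> k' = Suc k" "orthonormal k' e'"
    "\<And>i. i < k \<Longrightarrow> e' i = e i" "span (e' ` {..<k'}) = span (insert x (e ` {..<k}))"
proof (cases "x \<in> span (e ` {..<k})")
  case True
  then show thesis
    using that[of k e] e by (simp add: span_redundant)
next
  case False
  define p where "p = (\<Sum>i<k. inner x (e i) *\<^sub>R e i)"
  define z where "z = (x - p) /\<^sub>R norm (x - p)"
  have p: "p \<in> span (e ` {..<k})"
    unfolding p_def by (rule sum_scaleR_in_span)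
  have xp: "norm (x - p) \<noteq> 0" using p False by auto
  have z_orth: "inner z (e j) = 0" if "j < k" for j
    using orthonormal_residual[OF e that, of x] by (simp add: z_def p_def)
  have z_unit: "inner z z = 1"
    using xp by (simp add: z_def power2_norm_eq_inner[symmetric] power2_eq_square)
  let ?e = "e(k := z)"
  have img: "?e ` {..<Suc k} = insert z (e ` {..<k})"
    by (auto simp: lessThan_Suc)
  have "orthonormal (Suc k) ?e"
    unfolding orthonormal_def
    using orthonormal_inner[OF e] z_orth z_unit by (auto simp: less_Suc_eq inner_commute)
  moreover have "span (insert z (e ` {..<k})) = span (insert x (e ` {..<k}))"
  proof (rule span_eq[THEN iffD2], intro conjI)
    have px: "p \<in> span (insert x (e ` {..<k}))" "p \<in> span (insert z (e ` {..<k}))"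
      using p span_mono[of "e ` {..<k}"] by blast+
    then have "z \<in> span (insert x (e ` {..<k}))"
      unfolding z_def by (intro span_scale span_diff) (auto intro: span_base)
    then show "insert z (e ` {..<k}) \<subseteq> span (insert x (e ` {..<k}))"
      by (auto intro: span_base)
    have "x = norm (x - p) *\<^sub>R z + p"
      using xp by (simp add: z_def)
    also have "\<dots> \<in> span (insert z (e ` {..<k}))"
      using px by (intro span_add span_scale) (auto intro: span_base)
    finally show "insert x (e ` {..<k}) \<subseteq> span (insert z (e ` {..<k}))"
      by (auto intro: span_base)
  qed
  ultimately show thesis
    using that[of "Suc k" ?e] unfolding img by simp
qed

lemma Gram_Schmidt:
  "\<exists>k f. k \<le> n \<and> orthonormal k f \<and> span (f ` {..<k}) = span (v ` {..<n})"
proof (induction n)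
  case 0
  show ?case by (intro exI[of _ 0] exI[of _ v]) (simp add: orthonormal_def)
next
  case (Suc n)
  then obtain k f where f: "k \<le> n" "orthonormal k f" "span (f ` {..<k}) = span (v ` {..<n})" by blast
  obtain k' f' where f': "k' \<le> Suc k" "orthonormal k' f'"
    "span (f' ` {..<k'}) = span (insert (v n) (f ` {..<k}))"
    using Gram_Schmidt_step[OF f(2), of "v n"] by metis
  have "span (insert (v n) (f ` {..<k})) = span (v ` {..<Suc n})"
    using f(3) by (simp add: lessThan_Suc span_insert)
  then show ?case using f(1) f' by (intro exI[of _ k'] exI[of _ f']) simp
qed

text \<open>Gram-Schmidt may produce fewer than \<open>n\<close> vectors; padding them with zero vectors would then exhibit
  \<open>v\<close> as a linear image of a degenerate family.\<close>

lemma orthonormal_basis_of_span: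
  assumes "gram n v \<noteq> 0"
  obtains f where "orthonormal n f" "span (f ` {..<n}) = span (v ` {..<n})"
proof -
  obtain k f where f: "k \<le> n" "orthonormal k f" "span (f ` {..<k}) = span (v ` {..<n})"
    using Gram_Schmidt by blast
  have "k = n"
  proof (rule ccontr)
    assume "k \<noteq> n"
    then have k: "k < n" using f(1) by simp
    define g where "g i = (if i < k then f i else 0)" for i
    define M where "M = mat n n (\<lambda>(i, j). inner (v i) (f j))"
    have "gram n g = 0"
      unfolding gram_eq_0_iff
    proof (intro exI[of _ "\<lambda>i. if i = k then 1 else 0"] conjI)
      show "\<exists>i<n. (if i = k then 1 else 0) \<noteq> (0::real)" using k by auto
      show "(\<Sum>i<n. (if i = k then 1 else 0) *\<^sub>R g i) = 0"
        by (intro sum.neutral) (auto simp: g_def)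
    qed
    moreover have "gram n v = gram n (\<lambda>i. \<Sum>j<n. M $$ (i, j) *\<^sub>R g j)"
    proof (rule gram_cong)
      fix i assume i: "i < n"
      then have "v i \<in> span (f ` {..<k})"
        unfolding f(3) by (intro span_base) auto
      then have "v i = (\<Sum>j<k. inner (v i) (f j) *\<^sub>R f j)"
        using orthonormal_expansion[OF f(2)] by metis
      also have "\<dots> = (\<Sum>j<n. M $$ (i, j) *\<^sub>R g j)"
        using i f(1) by (intro sum.mono_neutral_cong_left) (auto simp: g_def M_def)
      finally show "v i = (\<Sum>j<n. M $$ (i, j) *\<^sub>R g j)" .
    qed
    moreover have "\<dots> = (det M)\<^sup>2 * gram n g"
      by (rule gram_change_of_basis) (simp add: M_def)
    ultimately show False using assms by simp
  qed
  with f that show thesis by blast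
qed

lemma orthonormal_independent:
  assumes e: "orthonormal n e"
  shows "independent (e ` {..<n})" "card (e ` {..<n}) = n"
proof -
  have "independent (e ` {..<k}) \<and> card (e ` {..<k}) = k" if "k \<le> n" for k
    using that
  proof (induction k)
    case 0
    show ?case by (simp add: independent_empty)
  next
    case (Suc k)
    have ek: "orthonormal k e" using e Suc.prems by (simp add: orthonormal_def)
    have "e k \<notin> span (e ` {..<k})"
    proof
      assume "e k \<in> span (e ` {..<k})"
      then have "e k = (\<Sum>i<k. inner (e k) (e i) *\<^sub>R e i)"
        using orthonormal_expansion[OF ek] by metis
      also have "\<dots> = 0"
        using Suc.prems by (intro sum.neutral) (auto simp: orthonormal_inner[OF e])
      finally show False
        using orthonormal_inner[OF e, of k k] Suc.prems by simp
    qed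
    moreover from this have "e k \<notin> e ` {..<k}" by (meson span_base)
    ultimately show ?case
      using Suc by (simp add: lessThan_Suc independent_insertI)
  qed
  from this[of n] show "independent (e ` {..<n})" "card (e ` {..<n}) = n" by auto
qed

lemma span_neq_UNIV:
  fixes B :: "'a::real_vector set"
  assumes "finite B" "enat (card B) < edim (UNIV :: 'a set)"
  obtains x where "x \<notin> span B"
proof -
  have "span B \<noteq> (UNIV :: 'a set)"
  proof
    assume sp: "span B = (UNIV :: 'a set)"
    then have "edim (UNIV :: 'a set) = enat (dim (UNIV :: 'a set))"
      using assms(1) by (auto simp: edim_def)
    moreover have "dim (UNIV :: 'a set) \<le> card B"
      using sp assms(1) by (intro dim_le_card) auto
    ultimately show False using assms(2) by simp
  qed
  then show thesis using that by blast
qed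

text \<open>The extended dimension guarantees a vector outside the span of any \<open>m\<close> vectors with \<open>m\<close> below it, also when
  it is infinite.\<close>

lemma orthonormal_extend:
  fixes e :: "nat \<Rightarrow> 'a::real_inner"
  assumes "orthonormal k e" "k \<le> m" "enat m \<le> edim (UNIV :: 'a set)"
  obtains e' where "orthonormal m e'" "\<And>i. i < k \<Longrightarrow> e' i = e i"
proof -
  have "\<exists>e'. orthonormal m e' \<and> (\<forall>i<k. e' i = e i)"
    using assms(2,3)
  proof (induction m rule: dec_induct)
    case base
    show ?case using assms(1) by blast
  next
    case (step m)
    have m: "enat m < edim (UNIV :: 'a set)"
      using step.prems by (meson enat_ord_simps(2) lessI less_le_trans)
    then have "enat m \<le> edim (UNIV :: 'a set)" by simp
    with step.IH obtain e' where e': "orthonormal m e'" "\<And>i. i < k \<Longrightarrow> e' i = e i" by blast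
    obtain x where "x \<notin> span (e' ` {..<m})"
      using span_neq_UNIV[of "e' ` {..<m}"] m orthonormal_independent(2)[OF e'(1)] by auto
    with Gram_Schmidt_step[OF e'(1), of x] obtain e''
      where "orthonormal (Suc m) e''" "\<And>i. i < m \<Longrightarrow> e'' i = e' i" by metis
    then show ?case using e'(2) step.hyps by (intro exI[of _ e'']) auto
  qed
  then show thesis using that by blast
qed

lemma orthonormal_exists:
  assumes "enat n \<le> edim (UNIV :: 'a::real_inner set)"
  obtains e :: "nat \<Rightarrow> 'a::real_inner" where "orthonormal n e"
proof -
  have "orthonormal 0 (\<lambda>_. 0 :: 'a)" by (simp add: orthonormal_def)
  then show thesis
    using orthonormal_extend assms that by blast
qed

lemma edim_eq_enatD:
  assumes "edim (UNIV :: 'a::real_vector set) = enat n"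
  shows "dim (UNIV :: 'a::real_vector set) = n"
    "\<exists>B :: 'a::real_vector set. finite B \<and> card B = n \<and> span B = UNIV"
proof -
  obtain B :: "'a set" where B: "finite B" "span B = UNIV"
    and dim: "dim (UNIV :: 'a set) = n"
    using assms by (auto simp: edim_def split: if_splits)
  show "dim (UNIV :: 'a set) = n" by (fact dim)
  obtain C :: "'a set" where C: "independent C" "UNIV \<subseteq> span C" "card C = dim (UNIV :: 'a set)"
    by (metis basis_exists)
  have "finite C"
    using independent_span_bound[OF B(1) C(1)] unfolding B(2) by blast
  then show "\<exists>B :: 'a set. finite B \<and> card B = n \<and> span B = UNIV"
    using C dim by (intro exI[of _ C]) auto
qed

lemma orthonormal_spans:
  fixes e :: "nat \<Rightarrow> 'a::real_inner"
  assumes dim: "edim (UNIV :: 'a set) = enat n" and e: "orthonormal n e"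
  shows "span (e ` {..<n}) = UNIV"
proof (rule ccontr)
  assume "span (e ` {..<n}) \<noteq> UNIV"
  then obtain x where x: "x \<notin> span (e ` {..<n})" by blast
  obtain B :: "'a set" where B: "finite B" "card B = n" "span B = UNIV"
    using edim_eq_enatD(2)[OF dim] by blast
  have "independent (insert x (e ` {..<n}))"
    using x orthonormal_independent(1)[OF e] by (rule independent_insertI)
  then have "card (insert x (e ` {..<n})) \<le> n"
    using independent_span_bound[OF B(1)] B by auto
  moreover have "x \<notin> e ` {..<n}" using x by (meson span_base)
  ultimately show False
    using orthonormal_independent(2)[OF e] by simp
qed

lemma orthonormal_span_three:
  fixes u x y :: "'a::real_inner"
  assumes "3 \<le> n" "enat n \<le> edim (UNIV :: 'a set)"
  obtains e where "orthonormal n e" "span {u, x, y} \<subseteq> span (e ` {..<n})"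
proof -
  define v where "v = (\<lambda>i::nat. if i = 0 then u else if i = 1 then x else y)"
  obtain k f where f: "k \<le> 3" "orthonormal k f" "span (f ` {..<k}) = span (v ` {..<3})"
    using Gram_Schmidt by blast
  obtain e where e: "orthonormal n e" "\<And>i. i < k \<Longrightarrow> e i = f i"
    using orthonormal_extend[OF f(2) _ assms(2)] f(1) assms(1) by auto
  have "v ` {..<3} = {u, x, y}"
    by (auto simp: v_def lessThan_Suc numeral_3_eq_3)
  moreover have "f ` {..<k} \<subseteq> e ` {..<n}"
  proof (rule image_subsetI)
    fix i assume "i \<in> {..<k}"
    then have "i < n" "e i = f i" using e(2) f(1) assms(1) by auto
    then show "f i \<in> e ` {..<n}" by (metis imageI lessThan_iff)
  qed
  ultimately have "span {u, x, y} \<subseteq> span (e ` {..<n})"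
    using f(3) span_mono by metis
  with e(1) show thesis by (rule that)
qed

section \<open>Sign-linearity on an n-dimensional subspace\<close>

text \<open>Coordinates after the basis vector \<open>v j\<close> is exchanged for \<open>w\<close>: the multiple
  \<open>t *\<^sub>R w\<close> is split off, with \<open>t\<close> such that the rest has no component along \<open>v j\<close>.\<close>

lemma sum_replace_by_sum:
  fixes n :: nat and v :: "nat \<Rightarrow> 'a::real_vector"
  assumes "j < n" "c j = t * s j" "w = (\<Sum>l<n. s l *\<^sub>R v l)"
  shows "(\<Sum>l<n. (if l = j then t else c l - t * s l) *\<^sub>R (v(j := w)) l) = (\<Sum>l<n. c l *\<^sub>R v l)"
    (is "?L = _")
proof -
  have "?L = t *\<^sub>R w + (\<Sum>l\<in>{..<n} - {j}. (c l - t * s l) *\<^sub>R v l)"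
    using assms(1) by (subst sum.remove[of _ j]) (auto intro!: sum.cong)
  also have "(\<Sum>l\<in>{..<n} - {j}. (c l - t * s l) *\<^sub>R v l) = (\<Sum>l<n. (c l - t * s l) *\<^sub>R v l)"
    using assms by (intro sum.mono_neutral_left) auto
  also have "\<dots> = (\<Sum>l<n. c l *\<^sub>R v l) - t *\<^sub>R w"
    by (simp add: assms(3) scaleR_diff_left sum_subtractf scaleR_sum_right)
  finally show ?thesis by simp
qed

locale volume_preserving =
  fixes \<phi> :: "'e::real_inner \<Rightarrow> 'f::real_inner" and n :: nat
  assumes gram_image: "gram n (\<lambda>i. \<phi> (v i)) = gram n v"
begin

lemma gram_image_replace: "gram n ((\<lambda>i. \<phi> (v i))(k := \<phi> z)) = gram n (v(k := z))"
proof -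
  have "(\<lambda>i. \<phi> (v i))(k := \<phi> z) = (\<lambda>i. \<phi> ((v(k := z)) i))" by auto
  then show ?thesis by (simp only: gram_image)
qed

text \<open>Both squares are the ratio by which the Gram determinant changes when \<open>z\<close> is put in slot \<open>i\<close>.\<close>

lemma coordinate_square:
  assumes "gram n e \<noteq> 0" "i < n"
    and "z = (\<Sum>l<n. c l *\<^sub>R e l)" "\<phi> z = (\<Sum>l<n. a l *\<^sub>R \<phi> (e l))"
  shows "(a i)\<^sup>2 = (c i)\<^sup>2"
proof -
  have "(a i)\<^sup>2 * gram n e = gram n ((\<lambda>l. \<phi> (e l))(i := \<phi> z))"
    unfolding assms(4) using gram_replace[OF assms(2), of "\<lambda>l. \<phi> (e l)" a] by (simp only: gram_image)
  also have "\<dots> = (c i)\<^sup>2 * gram n e"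
    unfolding gram_image_replace assms(3) by (rule gram_replace[OF assms(2)])
  finally show ?thesis using assms(1) by simp
qed

text \<open>Putting \<open>z\<close> in slot \<open>k\<close> gives a dependent family, hence a dependent image, in which only \<open>\<phi> z\<close> can be
  a combination of the others.\<close>

lemma image_in_span_of_zero_coordinate:
  assumes "gram n e \<noteq> 0" "k < n" "z = (\<Sum>l<n. c l *\<^sub>R e l)" "c k = 0"
  shows "\<phi> z \<in> span ((\<lambda>l. \<phi> (e l)) ` {..<n})"
proof -
  have "gram n ((\<lambda>l. \<phi> (e l))(k := \<phi> z)) = 0"
    unfolding gram_image_replace assms(3) gram_replace[OF assms(2)] using assms(4) by simp
  moreover have "gram n (\<lambda>l. \<phi> (e l)) \<noteq> 0"
    using assms(1) by (simp add: gram_image)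
  ultimately obtain a where "\<phi> z = (\<Sum>l<n. a l *\<^sub>R \<phi> (e l))"
    using replace_by_combination[of n "\<lambda>l. \<phi> (e l)" k] assms(2) by metis
  then show ?thesis using sum_scaleR_in_span by metis
qed

text \<open>Suppose that coordinate 0 of \<open>z\<close> does not vanish, and split off the component along \<open>e 2\<close>: the rest \<open>z'\<close> has vanishing coordinate 2, and with respect to
  the basis in which \<open>z'\<close> replaces \<open>e 0\<close> the vector \<open>z\<close> has vanishing coordinate 1. Three different
  indices are needed for this.\<close>

lemma image_in_span:
  assumes "3 \<le> n" "gram n e \<noteq> 0" "z = (\<Sum>l<n. c l *\<^sub>R e l)"
  shows "\<phi> z \<in> span ((\<lambda>l. \<phi> (e l)) ` {..<n})"
proof (cases "c 0 = 0")
  case True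
  then show ?thesis
    using image_in_span_of_zero_coordinate[of e 0] assms by auto
next
  case False
  define z' where "z' = (\<Sum>l<n. (c(2 := 0)) l *\<^sub>R e l)"
  define e' where "e' = e(0 := z')"
  have z': "\<phi> z' \<in> span ((\<lambda>l. \<phi> (e l)) ` {..<n})"
    using image_in_span_of_zero_coordinate[of e 2 z' "c(2 := 0)"] assms z'_def by auto
  have "gram n e' = (c 0)\<^sup>2 * gram n e"
    unfolding e'_def z'_def using assms(1) by (subst gram_replace) auto
  then have e': "gram n e' \<noteq> 0" using False assms(2) by simp
  let ?d = "\<lambda>l. if l = 0 then 1 else if l = 2 then c 2 else 0"
  have "z = z' + c 2 *\<^sub>R e 2"
    unfolding assms(3) z'_def using assms(1)
    by (subst (1 2) sum.remove[of _ 2]) (auto intro!: sum.cong)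
  also have "\<dots> = (\<Sum>l\<in>{0, 2}. ?d l *\<^sub>R e' l)"
    by (simp add: e'_def)
  also have "\<dots> = (\<Sum>l<n. ?d l *\<^sub>R e' l)"
    using assms(1) by (intro sum.mono_neutral_left) auto
  finally have "\<phi> z \<in> span ((\<lambda>l. \<phi> (e' l)) ` {..<n})"
    using image_in_span_of_zero_coordinate[of e' 1] e' assms(1) by auto
  moreover have "(\<lambda>l. \<phi> (e' l)) ` {..<n} \<subseteq> span ((\<lambda>l. \<phi> (e l)) ` {..<n})"
  proof (rule image_subsetI)
    fix l assume "l \<in> {..<n}"
    then have "\<phi> (e l) \<in> span ((\<lambda>l. \<phi> (e l)) ` {..<n})"
      by (intro span_base imageI)
    then show "\<phi> (e' l) \<in> span ((\<lambda>l. \<phi> (e l)) ` {..<n})"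
      using z' by (simp add: e'_def)
  qed
  ultimately show ?thesis
    using span_minimal[OF _ subspace_span] by blast
qed

text \<open>The signs of the image basis \<open>g\<close> are fixed by the image of \<open>w\<close>, the sum of the \<open>e l\<close>. Comparing coordinates
  with respect to \<open>e\<close>, and with respect to \<open>e\<close> with \<open>w\<close> in slot \<open>j\<close>, shows that \<open>b i * b j = c i * c j\<close> for the
  coordinates \<open>b\<close> of \<open>\<phi> z\<close> and \<open>c\<close> of \<open>z\<close>, hence \<open>b = c\<close> or \<open>b = - c\<close>.\<close>

lemma sign_linear_on_frame:
  assumes n: "3 \<le> n" and e: "gram n e \<noteq> 0"
  obtains g where "\<And>c. let z = (\<Sum>l<n. c l *\<^sub>R e l); y = (\<Sum>l<n. c l *\<^sub>R g l) in \<phi> z = y \<or> \<phi> z = - y"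
proof -
  define f where "f = (\<lambda>l. \<phi> (e l))"
  define w where "w = (\<Sum>l<n. e l)"
  have w: "w = (\<Sum>l<n. 1 *\<^sub>R e l)" by (simp add: w_def)
  obtain s where s: "\<phi> w = (\<Sum>l<n. s l *\<^sub>R f l)"
    unfolding f_def using image_in_span[OF n e w] by (rule span_image_lessThan)
  have s2: "(s i)\<^sup>2 = 1" if "i < n" for i
    using coordinate_square[OF e that w] s unfolding f_def by simp
  show thesis
  proof (rule that[of "\<lambda>l. s l *\<^sub>R f l"], unfold Let_def)
    fix c
    define z where "z = (\<Sum>l<n. c l *\<^sub>R e l)"
    obtain a where a: "\<phi> z = (\<Sum>l<n. a l *\<^sub>R f l)"
      unfolding f_def using image_in_span[OF n e z_def] by (rule span_image_lessThan)
    define b where "b i = a i * s i" for i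
    have ab: "a i = b i * s i" if "i < n" for i
      using s2[OF that] by (simp add: b_def power2_eq_square)
    have zb: "\<phi> z = (\<Sum>l<n. b l *\<^sub>R s l *\<^sub>R f l)"
      unfolding a by (intro sum.cong) (auto simp: ab)
    have sq: "(b i)\<^sup>2 = (c i)\<^sup>2" if "i < n" for i
      using coordinate_square[OF e that z_def] a s2[OF that]
      by (simp add: b_def f_def power_mult_distrib)
    have prod: "b i * b j = c i * c j" if ij: "i < n" "j < n" for i j
    proof (cases "i = j")
      case True
      then show ?thesis using sq[OF ij(1)] by (simp add: power2_eq_square)
    next
      case False
      have gj: "gram n (e(j := w)) \<noteq> 0"
        unfolding w gram_replace[OF ij(2)] using e by simp
      have ze: "z = (\<Sum>l<n. (if l = j then c j else c l - c j * 1) *\<^sub>R (e(j := w)) l)"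
        unfolding z_def by (rule sum_replace_by_sum[OF ij(2) _ w, symmetric]) simp
      have "\<phi> z = (\<Sum>l<n. (if l = j then b j else a l - b j * s l) *\<^sub>R (f(j := \<phi> w)) l)"
        unfolding a by (rule sum_replace_by_sum[OF ij(2), of a "b j" s, OF ab[OF ij(2)] s, symmetric])
      also have "f(j := \<phi> w) = (\<lambda>l. \<phi> ((e(j := w)) l))"
        by (auto simp: f_def)
      finally have "(a i - b j * s i)\<^sup>2 = (c i - c j)\<^sup>2"
        using coordinate_square[OF gj ij(1) ze, of "\<lambda>l. if l = j then b j else a l - b j * s l"] False
        by simp
      moreover have "(a i - b j * s i)\<^sup>2 = (b i - b j)\<^sup>2"
        using s2[OF ij(1)] by (simp add: ab[OF ij(1)] left_diff_distrib[symmetric] power_mult_distrib)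
      ultimately show ?thesis
        using sq[OF ij(1)] sq[OF ij(2)] by (simp add: power2_diff)
    qed
    have "(\<forall>i<n. b i = c i) \<or> (\<forall>i<n. b i = - c i)"
    proof (cases "\<exists>p<n. c p \<noteq> 0")
      case True
      then obtain p where p: "p < n" "c p \<noteq> 0" by blast
      from sq[OF p(1)] have "b p = c p \<or> b p = - c p" by (simp add: power2_eq_iff)
      then show ?thesis
      proof
        assume bp: "b p = c p"
        have "b i = c i" if "i < n" for i
          using prod[OF that p(1)] p(2) by (simp add: bp)
        then show ?thesis by blast
      next
        assume bp: "b p = - c p"
        have "b i = - c i" if "i < n" for i
        proof -
          have "(- b i) * c p = c i * c p"
            using prod[OF that p(1)] by (simp add: bp)
          then show ?thesis using p(2) by (simp only: mult_cancel_right) simp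
        qed
        then show ?thesis by blast
      qed
    next
      case False
      then show ?thesis using sq by simp
    qed
    then show "\<phi> z = (\<Sum>l<n. c l *\<^sub>R s l *\<^sub>R f l) \<or> \<phi> z = - (\<Sum>l<n. c l *\<^sub>R s l *\<^sub>R f l)"
      unfolding zb by (auto simp: sum_negf[symmetric])
  qed
qed

lemma sign_linear_on_orthonormal_span:
  assumes "3 \<le> n" "orthonormal n e"
  obtains A where "linear A" "\<And>z. z \<in> span (e ` {..<n}) \<Longrightarrow> \<phi> z = A z \<or> \<phi> z = - A z"
proof -
  obtain g where g: "\<And>c. let z = (\<Sum>l<n. c l *\<^sub>R e l); y = (\<Sum>l<n. c l *\<^sub>R g l) in \<phi> z = y \<or> \<phi> z = - y"
    using sign_linear_on_frame[OF assms(1), of e] gram_orthonormal[OF assms(2)] by auto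
  let ?A = "\<lambda>z. \<Sum>l<n. inner z (e l) *\<^sub>R g l"
  have "linear ?A"
    by (rule linearI) (simp_all add: inner_add_left scaleR_add_left sum.distrib scaleR_sum_right)
  moreover have "\<phi> z = ?A z \<or> \<phi> z = - ?A z" if "z \<in> span (e ` {..<n})" for z
    using g[of "\<lambda>l. inner z (e l)", unfolded Let_def] orthonormal_expansion[OF assms(2) that] by simp
  ultimately show thesis by (rule that)
qed

end

section \<open>Gluing\<close>

text \<open>Two local linear maps that both send \<open>u\<close> to \<open>\<phi> u\<close> agree at every common \<open>z\<close>: each is \<open>\<phi>\<close> up to sign at \<open>z\<close>
  and at \<open>z + u\<close>, and opposite signs at both points would give \<open>\<phi> u = - \<phi> u\<close>. So the value at \<open>z\<close> of a
  normalised local map is a well-defined function of \<open>z\<close>, and linear because any two arguments lie in a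
  common local domain.\<close>

lemma sign_linear_glue:
  fixes \<phi> :: "'a::real_vector \<Rightarrow> 'b::real_vector"
  assumes local: "\<And>u x y. \<exists>A. linear A \<and> (\<forall>z \<in> span {u, x, y}. \<phi> z = A z \<or> \<phi> z = - A z)"
    and u: "\<phi> u \<noteq> 0"
  obtains R where "linear R" "\<And>z. \<phi> z = R z \<or> \<phi> z = - R z"
proof -
  define P where "P A x y \<longleftrightarrow> linear A \<and> A u = \<phi> u \<and> (\<forall>z \<in> span {u, x, y}. \<phi> z = A z \<or> \<phi> z = - A z)"
    for A x y
  have ex: "\<exists>A. P A x y" for x y
  proof -
    obtain A where A: "linear A" "\<forall>z \<in> span {u, x, y}. \<phi> z = A z \<or> \<phi> z = - A z"
      using local by blast
    then have "\<phi> u = A u \<or> \<phi> u = - A u" by (auto intro: span_base)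
    then show ?thesis
    proof
      assume "\<phi> u = A u"
      then show ?thesis using A unfolding P_def by auto
    next
      assume "\<phi> u = - A u"
      moreover have "linear (\<lambda>z. - A z)"
        using A(1) by (rule linear_compose_neg)
      ultimately show ?thesis
        using A(2) unfolding P_def by (intro exI[of _ "\<lambda>z. - A z"]) auto
    qed
  qed
  have unique: "A z = A' z"
    if A: "P A x y" and A': "P A' x' y'" and z: "z \<in> span {u, x, y}" "z \<in> span {u, x', y'}"
    for A A' x y x' y' z
  proof -
    have zu: "z + u \<in> span {u, x, y}" "z + u \<in> span {u, x', y'}"
      using z by (auto intro: span_add span_base)
    have lin: "A (z + u) = A z + \<phi> u" "A' (z + u) = A' z + \<phi> u"
      using A A' by (simp_all add: P_def linear_add)
    have "A z = A' z \<or> A z = - A' z"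
      using A A' z unfolding P_def by (metis minus_minus)
    moreover have "A (z + u) = A' (z + u) \<or> A (z + u) = - A' (z + u)"
      using A A' zu unfolding P_def by (metis minus_minus)
    ultimately consider "A z = A' z" | "A z = - A' z" "A z + \<phi> u = - (A' z + \<phi> u)"
      unfolding lin by auto
    then show ?thesis
    proof cases
      case 2
      then have "\<phi> u = - \<phi> u" by simp
      then have "2 *\<^sub>R \<phi> u = 0" by (simp add: scaleR_2 eq_neg_iff_add_eq_0)
      with u show ?thesis by simp
    qed
  qed
  define R where "R x = (SOME A. P A x x) x" for x
  have R: "R z = A z" if "P A x y" "z \<in> span {u, x, y}" for A x y z
    unfolding R_def using unique[OF someI_ex[OF ex[of z z]] that(1) _ that(2)] by (auto intro: span_base)
  show thesis
  proof (rule that)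
    show "linear R"
    proof (rule linearI)
      fix x y :: 'a and r :: real
      obtain A where A: "P A x y" using ex by blast
      have xy: "x \<in> span {u, x, y}" "y \<in> span {u, x, y}" by (auto intro: span_base)
      then have "x + y \<in> span {u, x, y}" "r *\<^sub>R x \<in> span {u, x, y}"
        by (auto intro: span_add span_scale)
      with xy R[OF A] A show "R (x + y) = R x + R y" "R (r *\<^sub>R x) = r *\<^sub>R R x"
        by (simp_all add: P_def linear_add linear_scale)
    qed
    fix z
    obtain A where A: "P A z z" using ex by blast
    have "z \<in> span {u, z, z}" by (auto intro: span_base)
    with A R[OF A] show "\<phi> z = R z \<or> \<phi> z = - R z"
      by (auto simp: P_def)
  qed
qed

lemma (in volume_preserving) globally_sign_linear:
  assumes n: "3 \<le> n" "enat n \<le> edim (UNIV :: 'e set)"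
  obtains R where "linear R" "\<And>z. \<phi> z = R z \<or> \<phi> z = - R z" "volume_preserving R n"
proof -
  have local: "\<exists>A. linear A \<and> (\<forall>z \<in> span {u, x, y}. \<phi> z = A z \<or> \<phi> z = - A z)" for u x y
  proof -
    obtain e where e: "orthonormal n e" "span {u, x, y} \<subseteq> span (e ` {..<n})"
      using orthonormal_span_three[OF n] by blast
    show ?thesis
      using sign_linear_on_orthonormal_span[OF n(1) e(1)] e(2) by (metis subsetD)
  qed
  obtain e :: "nat \<Rightarrow> 'e" where e: "orthonormal n e"
    using orthonormal_span_three[OF n] by blast
  have "\<phi> (e 0) \<noteq> 0"
  proof
    assume "\<phi> (e 0) = 0"
    then have "(\<Sum>i<n. (if i = 0 then 1 else 0) *\<^sub>R \<phi> (e i)) = 0"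
      by (intro sum.neutral) auto
    then have "gram n (\<lambda>i. \<phi> (e i)) = 0"
      unfolding gram_eq_0_iff using n(1)
      by (intro exI[of _ "\<lambda>i. if i = 0 then 1 else 0"]) auto
    then show False
      using gram_orthonormal[OF e] gram_image by simp
  qed
  with sign_linear_glue[of \<phi> "e 0", OF local] obtain R
    where R: "linear R" "\<And>z. \<phi> z = R z \<or> \<phi> z = - R z" by metis
  have "volume_preserving R n"
  proof
    fix v
    show "gram n (\<lambda>i. R (v i)) = gram n v"
      using gram_sign_cong[of n "\<lambda>i. \<phi> (v i)" "\<lambda>i. R (v i)"] R(2) gram_image by metis
  qed
  with R show thesis by (rule that)
qed

section \<open>Linear volume-preserving maps\<close>

text \<open>The Gram determinant of the image of an orthonormal basis is both 1 and the square of the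
  determinant of the representing matrix.\<close>

lemma (in volume_preserving) equiaffine_of_linear:
  assumes lin: "linear \<phi>" and dim: "edim (UNIV :: 'e set) = enat n"
  shows "equiaffine \<phi>"
proof -
  have "enat n \<le> edim (UNIV :: 'e set)" using dim by simp
  then obtain e :: "nat \<Rightarrow> 'e" where e: "orthonormal n e"
    by (rule orthonormal_exists)
  have e_span: "span (e ` {..<n}) = UNIV"
    using dim e by (rule orthonormal_spans)
  obtain f where f: "orthonormal n f" "span (f ` {..<n}) = span ((\<lambda>i. \<phi> (e i)) ` {..<n})"
    using orthonormal_basis_of_span[of n "\<lambda>i. \<phi> (e i)"] gram_orthonormal[OF e] gram_image by auto
  have f_span: "span (f ` {..<n}) = range \<phi>"
    using linear_span_image[OF lin, of "e ` {..<n}"] unfolding f(2) e_span by (simp add: image_image)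
  \<comment> \<open>Columns hold the images, as in a representing matrix; the change of basis below therefore uses its transpose.\<close>
  define M where "M = mat n n (\<lambda>(i, j). inner (\<phi> (e j)) (f i))"
  have M: "M \<in> carrier_mat n n" by (simp add: M_def)
  have col: "\<phi> (e j) = (\<Sum>i<n. M $$ (i, j) *\<^sub>R f i)" if "j < n" for j
    using orthonormal_expansion[OF f(1), of "\<phi> (e j)"] that
    unfolding f_span by (simp add: M_def)
  have "1 = gram n (\<lambda>i. \<phi> (e i))"
    using gram_orthonormal[OF e] gram_image by simp
  also have "\<dots> = gram n (\<lambda>i. \<Sum>j<n. M\<^sup>T $$ (i, j) *\<^sub>R f j)"
    using M by (intro gram_cong) (simp add: col)
  also have "\<dots> = (det M)\<^sup>2"
    using gram_change_of_basis[of "M\<^sup>T" n f] M gram_orthonormal[OF f(1)]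
    by (simp add: det_transpose)
  finally have "det M = 1 \<or> det M = -1"
    by (metis power2_eq_1_iff)
  then show ?thesis
    unfolding equiaffine_def orthonormal_basis_def represents_def edim_eq_enatD(1)[OF dim]
    using lin e e_span f(1) f_span M col
    by (auto simp: orthonormal_def intro!: exI[of _ e] exI[of _ f] exI[of _ M])
qed

text \<open>The images \<open>v i\<close> of \<open>y i\<close> for \<open>i < n\<close> are independent. Write \<open>v n = p + w\<close> with \<open>p\<close> in their span, with coordinates
  \<open>c\<close>, and \<open>w\<close> orthogonal to it. Shearing slot \<open>i\<close> by \<open>b\<close> times the last vector changes the squared volume from 1 to
  \<open>1 + b\<^sup>2\<close> in the domain and to \<open>(1 + b * c i)\<^sup>2 + K b\<^sup>2\<close>, for a constant \<open>K\<close>, in the codomain;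
  comparing the coefficients of \<open>b\<close> gives \<open>c i = 0\<close>.\<close>

lemma (in volume_preserving) linear_preserves_orthogonality:
  assumes lin: "linear \<phi>" and y: "orthonormal (Suc n) y" and k: "k < n"
  shows "inner (\<phi> (y n)) (\<phi> (y k)) = 0"
proof -
  define v where "v i = \<phi> (y i)" for i
  have yn: "orthonormal n y" using y by (simp add: orthonormal_def)
  have gv: "gram n v = 1"
    unfolding v_def gram_image by (rule gram_orthonormal[OF yn])
  obtain f where f: "orthonormal n f" "span (f ` {..<n}) = span (v ` {..<n})"
    using orthonormal_basis_of_span[of n v] gv by auto
  define p where "p = (\<Sum>i<n. inner (v n) (f i) *\<^sub>R f i)"
  define w where "w = v n - p"
  have "p \<in> span (v ` {..<n})"
    unfolding p_def f(2)[symmetric] by (rule sum_scaleR_in_span)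
  then obtain c where c: "p = (\<Sum>i<n. c i *\<^sub>R v i)" by (rule span_image_lessThan)
  have w_f: "inner w (f i) = 0" if "i < n" for i
    unfolding w_def p_def using f(1) that by (rule orthonormal_residual)
  have w_span: "inner w x = 0" if x: "x \<in> span (v ` {..<n})" for x
  proof -
    have "inner w (\<Sum>i<n. inner x (f i) *\<^sub>R f i) = 0"
      by (simp add: inner_sum_right w_f)
    then show ?thesis
      using orthonormal_expansion[OF f(1)] x f(2) by simp
  qed
  have w_v: "inner w (v i) = 0" if "i < n" for i
    using that by (intro w_span span_base) auto
  have "c i = 0" if i: "i < n" for i
  proof -
    obtain C where C: "\<And>x w. (\<And>j. j < n \<Longrightarrow> j \<noteq> i \<Longrightarrow> inner w (v j) = 0) \<Longrightarrow> inner x w = 0 \<Longrightarrow>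
        gram n (v(i := x + w)) = gram n (v(i := x)) + C * inner w w"
      using gram_replace_add_orthogonal[OF i, of v] by blast
    have key: "1 + b\<^sup>2 = (1 + b * c i)\<^sup>2 + C * (b\<^sup>2 * inner w w)" for b :: real
    proof -
      let ?x = "v i + b *\<^sub>R p"
      let ?z = "y i + b *\<^sub>R y n"
      have pyth: "gram n (y(i := ?z)) = 1 + b\<^sup>2"
        using y i by (rule gram_orthonormal_shear)
      have "v i + b *\<^sub>R v n = ?x + b *\<^sub>R w"
        by (simp add: w_def scaleR_diff_right)
      then have "(\<lambda>j. \<phi> ((y(i := ?z)) j)) = v(i := ?x + b *\<^sub>R w)"
        using lin by (auto simp: v_def linear_add linear_scale)
      then have "gram n (y(i := ?z)) = gram n (v(i := ?x + b *\<^sub>R w))"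
        by (metis gram_image)
      also have "\<dots> = gram n (v(i := ?x)) + C * inner (b *\<^sub>R w) (b *\<^sub>R w)"
      proof (rule C)
        have "?x \<in> span (v ` {..<n})"
          using i \<open>p \<in> span (v ` {..<n})\<close> by (intro span_add span_scale) (auto intro: span_base)
        then have "inner w ?x = 0" by (rule w_span)
        then show "inner ?x (b *\<^sub>R w) = 0"
          by (simp add: inner_commute[of w])
      qed (simp add: w_v)
      also have "?x = (\<Sum>j<n. ((if j = i then 1 else 0) + b * c j) *\<^sub>R v j)"
        using i by (simp add: c scaleR_add_left sum.distrib scaleR_sum_right
            if_distrib[of "\<lambda>t. t *\<^sub>R _"] cong: if_cong)
      also have "gram n (v(i := \<dots>)) = (1 + b * c i)\<^sup>2"
        using gram_replace[OF i, of v "\<lambda>j. (if j = i then 1 else 0) + b * c j"] gv by simp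
      finally show ?thesis
        unfolding pyth by (simp add: power2_eq_square)
    qed
    \<comment> \<open>The difference of the two instances isolates the linear term in the parameter.\<close>
    from key[of 1] key[of "-1"] show "c i = 0"
      by (simp add: power2_eq_square algebra_simps)
  qed
  then have "p = 0" unfolding c by simp
  then show ?thesis
    using w_v[OF k] by (simp add: w_def v_def)
qed

text \<open>Preserving orthogonality makes the map conformal, because \<open>x + y\<close> and \<open>x - y\<close> are orthogonal for unit
  vectors \<open>x\<close> and \<open>y\<close>. If \<open>l\<close> is the factor of the squared length, an orthonormal n-frame
  is mapped to a family with Gram determinant \<open>l ^ n\<close>, so \<open>l = 1\<close>.\<close>

lemma (in volume_preserving) linear_isometry_of_linear:
  assumes lin: "linear \<phi>" and n: "3 \<le> n" "enat n < edim (UNIV :: 'e set)"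
  shows "linear_isometry \<phi>"
proof -
  have dim: "enat (Suc n) \<le> edim (UNIV :: 'e set)"
    using n(2) by (simp add: Suc_ile_eq)
  have orth_unit: "inner (\<phi> x) (\<phi> y) = 0" if "norm x = 1" "norm y = 1" "inner x y = 0" for x y
  proof -
    have "orthonormal 2 (\<lambda>i. if i = 0 then x else y)"
      using that by (auto simp: orthonormal_def less_2_cases_iff norm_eq_1 inner_commute)
    then obtain e where e: "orthonormal (Suc n) e" "\<And>i. i < 2 \<Longrightarrow> e i = (if i = 0 then x else y)"
      using orthonormal_extend[of 2 _ "Suc n"] dim n(1) by auto
    \<comment> \<open>Moves \<open>y\<close> from index 1 to the last index \<open>n\<close>, while \<open>x\<close> stays at index 0.\<close>
    define e' where "e' = e \<circ> Transposition.transpose 1 n"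
    have "orthonormal (Suc n) e'"
      using e(1) n(1) unfolding orthonormal_def e'_def
      by (auto simp: Transposition.transpose_def)
    then have "inner (\<phi> (e' n)) (\<phi> (e' 0)) = 0"
      using n(1) by (intro linear_preserves_orthogonality[OF lin]) auto
    then show ?thesis
      using e(2)[of 0] e(2)[of 1] n(1) by (simp add: e'_def inner_commute)
  qed
  have orth: "inner (\<phi> x) (\<phi> y) = 0" if "inner x y = 0" for x y
  proof (cases "x = 0 \<or> y = 0")
    case True
    then show ?thesis using linear_0[OF lin] by auto
  next
    case False
    then have "inner (\<phi> (x /\<^sub>R norm x)) (\<phi> (y /\<^sub>R norm y)) = 0"
      using that by (intro orth_unit) auto
    then show ?thesis using False by (simp add: linear_scale[OF lin])
  qed
  obtain e :: "nat \<Rightarrow> 'e" where e: "orthonormal n e"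
    using orthonormal_exists[OF order_less_imp_le[OF n(2)]] by blast
  define l where "l = inner (\<phi> (e 0)) (\<phi> (e 0))"
  have unit: "inner (\<phi> x) (\<phi> x) = l" if "norm x = 1" for x
  proof -
    have "inner (x + e 0) (x - e 0) = 0"
      using that n(1) orthonormal_inner[OF e, of 0 0]
      by (simp add: inner_add_left inner_diff_right inner_commute[of "e 0" x] norm_eq_1)
    from orth[OF this] show ?thesis
      by (simp add: linear_add[OF lin] linear_diff[OF lin] inner_add_left inner_diff_right
          inner_commute[of "\<phi> (e 0)" "\<phi> x"] l_def)
  qed
  have "gram n (\<lambda>i. \<phi> (e i)) = det (l \<cdot>\<^sub>m 1\<^sub>m n)"
    unfolding gram_def
    by (intro arg_cong[where f = det] eq_matI)
       (auto simp: orth unit norm_eq_1 orthonormal_inner[OF e])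
  then have "l ^ n = 1"
    using gram_orthonormal[OF e] by (simp add: gram_image)
  moreover have "l \<ge> 0" by (simp add: l_def)
  ultimately have l: "l = 1"
    using n(1) by (metis power_eq_1_iff not_numeral_le_zero abs_of_nonneg real_norm_def)
  have "norm (\<phi> x) = norm x" for x
  proof (cases "x = 0")
    case True
    then show ?thesis using linear_0[OF lin] by simp
  next
    case False
    then have "inner (\<phi> (x /\<^sub>R norm x)) (\<phi> (x /\<^sub>R norm x)) = 1"
      using unit l by simp
    then have "norm (\<phi> (x /\<^sub>R norm x)) = 1" by (simp add: norm_eq_1)
    then show ?thesis using False by (simp add: linear_scale[OF lin] divide_simps)
  qed
  then show ?thesis
    unfolding linear_isometry_def dist_norm using lin by (metis linear_diff)
qed

section \<open>The classification\<close>

theorem corollary1: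
  fixes \<phi> :: "'e::real_inner \<Rightarrow> 'f::real_inner" and n :: nat
  assumes "3 \<le> n" and "enat n \<le> edim (UNIV :: 'e set)"
    and "\<And>x :: nat \<Rightarrow> 'e. Vol n x = Vol n (\<lambda>i. \<phi> (x i))"
  shows "(edim (UNIV :: 'e set) = enat n \<longrightarrow>
            (\<exists>(\<epsilon> :: 'e \<Rightarrow> real) (A :: 'e \<Rightarrow> 'f).
               (\<forall>x. \<epsilon> x \<in> {-1, 1}) \<and> equiaffine A \<and> (\<forall>x. \<phi> x = \<epsilon> x *\<^sub>R A x))) \<and>
         (enat n < edim (UNIV :: 'e set) \<longrightarrow>
            (\<exists>(\<epsilon> :: 'e \<Rightarrow> real) (R :: 'e \<Rightarrow> 'f).
               (\<forall>x. \<epsilon> x \<in> {-1, 1}) \<and> linear_isometry R \<and> (\<forall>x. \<phi> x = \<epsilon> x *\<^sub>R R x)))"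
proof -
  interpret volume_preserving \<phi> n
    using assms(3) by unfold_locales (simp add: Vol_def gram_def)
  obtain R where R: "linear R" "\<And>z. \<phi> z = R z \<or> \<phi> z = - R z" "volume_preserving R n"
    using globally_sign_linear assms(1,2) by blast
  define \<epsilon> :: "'e \<Rightarrow> real" where "\<epsilon> x = (if \<phi> x = R x then 1 else -1)" for x
  have \<epsilon>: "\<forall>x. \<epsilon> x \<in> {-1, 1}" "\<forall>x. \<phi> x = \<epsilon> x *\<^sub>R R x"
    using R(2) by (auto simp: \<epsilon>_def)
  show ?thesis
    using volume_preserving.equiaffine_of_linear[OF R(3,1)]
      volume_preserving.linear_isometry_of_linear[OF R(3,1)] \<epsilon> assms(1) by blast
qed

end
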